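(* Let $(X,\kappa)$ and $(Y,\lambda)$ be digital images. If $X\simeq_{\kappa,\lambda}Y$, then $X\simeq^s_{\kappa,\lambda}Y$. If $x_1\in X$, $y_1\in Y$ and $(X,x_1)\simeq_{\kappa,\lambda}(Y,y_1)$, then $(X,x_1)\simeq^s_{\kappa,\lambda}(Y,y_1)$.
   Context: A digital image $(X,\kappa)$ is a set $X\subset\mathbb Z^n$ (for some $n\ge 1$) with an adjacency relation $\kappa$ (a symmetric, irreflexive relation). A subset is $\kappa$-connected if any two distinct points of it are joined by a finite sequence of points of the subset whose consecutive members are $\kappa$-adjacent. A function $f:(X,\kappa)\to(Y,\lambda)$ is $(\kappa,\lambda)$-continuous if it maps $\kappa$-connected sets to $\lambda$-connected sets; equivalently, $\kappa$-adjacent points are mapped to equal or $\lambda$-adjacent points. $[a,b]_{\mathbb Z}=\{z\in\mathbb Z: a\le z\le b\}$; subsets of $\mathbb Z$ carry the adjacency in which consecutive integers are adjacent. Homotopy: continuous $f,g:X\to Y$ are homotopic in $Y$, $f\simeq_{\kappa,\lambda} g$, if there are a positive integer $m$ and $F:X\times[0,m]_{\mathbb Z}\to Y$ with $F(x,0)=f(x)$, $F(x,m)=g(x)$ for all $x$, such that $t\mapsto F(x,t)$ is continuous for each $x\in X$ and $x\mapsto F(x,t)$ is $(\kappa,\lambda)$-continuous for each $t$. $F$ holds $x$ fixed if $F(x,t)=F(x,0)$ for all $t$. $X\simeq_{\kappa,\lambda}Y$ (same homotopy type) if there are continuous $f:X\to Y$, $g:Y\to X$ with $g\circ f\simeq1_X$,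 $f\circ g\simeq1_Y$; $(X,x_1)\simeq_{\kappa,\lambda}(Y,y_1)$ if moreover $f(x_1)=y_1$, $g(y_1)=x_1$ and the homotopies can be chosen to hold $x_1$, respectively $y_1$, fixed. Homotopic similarity: $X\simeq^s_{\kappa,\lambda}Y$ if there are subsets $X_j\subset X$, $Y_j\subset Y$ ($j\ge1$) with $X_j\subset X_{j+1}$, $Y_j\subset Y_{j+1}$, $X=\bigcup_j X_j$, $Y=\bigcup_j Y_j$, and continuous $f_j:X_j\to Y_j$, $g_j:Y_j\to X_j$ such that $g_j\circ f_j\simeq_{\kappa,\kappa}1_{X_j}$ (in $X_j$), $f_j\circ g_j\simeq_{\lambda,\lambda}1_{Y_j}$ (in $Y_j$), and for $v\le w$, $f_w|_{X_v}\simeq_{\kappa,\lambda}f_v$ in $Y_v$ and $g_w|_{Y_v}\simeq_{\lambda,\kappa}g_v$ in $X_v$ (in particular $f_w(X_v)\subset Y_v$, $g_w(Y_v)\subset X_v$). $(X,x_1)\simeq^s_{\kappa,\lambda}(Y,y_1)$ means in addition $x_1\in X_1$, $y_1\in Y_1$, $f_j(x_1)=y_1$, $g_j(y_1)=x_1$ for all $j$, and all these homotopies hold the base point in their domain fixed. *)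

theory Defs
  imports "HOL-Analysis.Finite_Cartesian_Product"
begin

text \<open>
  A digital image is a set \<open>X\<close> of points of \<open>int ^ 'n\<close> together with a relation \<open>\<kappa>\<close>. Only the
  values of \<open>\<kappa>\<close> on \<open>X\<close> matter, and \<open>\<kappa>\<close> also serves as the adjacency of every subset of \<open>X\<close>.
\<close>

definition digital_image :: "(int ^ 'n) set \<Rightarrow> (int ^ 'n \<Rightarrow> int ^ 'n \<Rightarrow> bool) \<Rightarrow> bool" where
  "digital_image X \<kappa> \<longleftrightarrow> symp_on X \<kappa> \<and> irreflp_on X \<kappa>"

text \<open>
  The notions below are stated for an arbitrary point type, so that they apply both to \<open>int ^ 'n\<close>
  and to the time interval of a homotopy, a subset of \<open>int\<close>. Maps between images are total
  functions of which only the values on the domain are used; hence the restriction of a map to a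
  smaller set is the same function with another domain argument.
\<close>

definition int_adj :: "int \<Rightarrow> int \<Rightarrow> bool" where
  "int_adj a b \<longleftrightarrow> \<bar>a - b\<bar> = 1"

definition digital_connected :: "'a set \<Rightarrow> ('a \<Rightarrow> 'a \<Rightarrow> bool) \<Rightarrow> bool" where
  "digital_connected A \<kappa> \<longleftrightarrow>
     (\<forall>x\<in>A. \<forall>y\<in>A. x \<noteq> y \<longrightarrow>
        (\<exists>ps. ps \<noteq> [] \<and> hd ps = x \<and> last ps = y \<and> set ps \<subseteq> A \<and> successively \<kappa> ps))"

definition digital_continuous ::
  "'a set \<Rightarrow> ('a \<Rightarrow> 'a \<Rightarrow> bool) \<Rightarrow> 'b set \<Rightarrow> ('b \<Rightarrow> 'b \<Rightarrow> bool) \<Rightarrow> ('a \<Rightarrow> 'b) \<Rightarrow> bool" where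
  "digital_continuous X \<kappa> Y \<mu> f \<longleftrightarrow>
     f ` X \<subseteq> Y \<and>
     (\<forall>A. A \<subseteq> X \<and> digital_connected A \<kappa> \<longrightarrow> digital_connected (f ` A) \<mu>)"

definition digital_homotopy ::
  "'a set \<Rightarrow> ('a \<Rightarrow> 'a \<Rightarrow> bool) \<Rightarrow> 'b set \<Rightarrow> ('b \<Rightarrow> 'b \<Rightarrow> bool) \<Rightarrow>
   ('a \<Rightarrow> 'b) \<Rightarrow> ('a \<Rightarrow> 'b) \<Rightarrow> int \<Rightarrow> ('a \<times> int \<Rightarrow> 'b) \<Rightarrow> bool" where
  "digital_homotopy X \<kappa> Y \<mu> f g m F \<longleftrightarrow>
     digital_continuous X \<kappa> Y \<mu> f \<and> digital_continuous X \<kappa> Y \<mu> g \<and>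
     m > 0 \<and>
     F ` (X \<times> {0..m}) \<subseteq> Y \<and>
     (\<forall>x\<in>X. F (x, 0) = f x \<and> F (x, m) = g x) \<and>
     (\<forall>x\<in>X. digital_continuous {0..m} int_adj Y \<mu> (\<lambda>t. F (x, t))) \<and>
     (\<forall>t\<in>{0..m}. digital_continuous X \<kappa> Y \<mu> (\<lambda>x. F (x, t)))"

definition holds_fixed :: "('a \<times> int \<Rightarrow> 'b) \<Rightarrow> int \<Rightarrow> 'a \<Rightarrow> bool" where
  "holds_fixed F m x \<longleftrightarrow> (\<forall>t\<in>{0..m}. F (x, t) = F (x, 0))"

definition digital_homotopic ::
  "'a set \<Rightarrow> ('a \<Rightarrow> 'a \<Rightarrow> bool) \<Rightarrow> 'b set \<Rightarrow> ('b \<Rightarrow> 'b \<Rightarrow> bool) \<Rightarrow>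
   ('a \<Rightarrow> 'b) \<Rightarrow> ('a \<Rightarrow> 'b) \<Rightarrow> bool" where
  "digital_homotopic X \<kappa> Y \<mu> f g \<longleftrightarrow> (\<exists>m F. digital_homotopy X \<kappa> Y \<mu> f g m F)"

definition digital_homotopic_fixing ::
  "'a \<Rightarrow> 'a set \<Rightarrow> ('a \<Rightarrow> 'a \<Rightarrow> bool) \<Rightarrow> 'b set \<Rightarrow> ('b \<Rightarrow> 'b \<Rightarrow> bool) \<Rightarrow>
   ('a \<Rightarrow> 'b) \<Rightarrow> ('a \<Rightarrow> 'b) \<Rightarrow> bool" where
  "digital_homotopic_fixing x X \<kappa> Y \<mu> f g \<longleftrightarrow>
     (\<exists>m F. digital_homotopy X \<kappa> Y \<mu> f g m F \<and> holds_fixed F m x)"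

definition same_homotopy_type ::
  "'a set \<Rightarrow> ('a \<Rightarrow> 'a \<Rightarrow> bool) \<Rightarrow> 'b set \<Rightarrow> ('b \<Rightarrow> 'b \<Rightarrow> bool) \<Rightarrow> bool" where
  "same_homotopy_type X \<kappa> Y \<mu> \<longleftrightarrow>
     (\<exists>f g. digital_continuous X \<kappa> Y \<mu> f \<and> digital_continuous Y \<mu> X \<kappa> g \<and>
        digital_homotopic X \<kappa> X \<kappa> (g \<circ> f) id \<and>
        digital_homotopic Y \<mu> Y \<mu> (f \<circ> g) id)"

definition same_pointed_homotopy_type ::
  "'a set \<Rightarrow> 'a \<Rightarrow> ('a \<Rightarrow> 'a \<Rightarrow> bool) \<Rightarrow> 'b set \<Rightarrow> 'b \<Rightarrow> ('b \<Rightarrow> 'b \<Rightarrow> bool) \<Rightarrow> bool" where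
  "same_pointed_homotopy_type X x\<^sub>1 \<kappa> Y y\<^sub>1 \<mu> \<longleftrightarrow>
     (\<exists>f g. digital_continuous X \<kappa> Y \<mu> f \<and> digital_continuous Y \<mu> X \<kappa> g \<and>
        f x\<^sub>1 = y\<^sub>1 \<and> g y\<^sub>1 = x\<^sub>1 \<and>
        digital_homotopic_fixing x\<^sub>1 X \<kappa> X \<kappa> (g \<circ> f) id \<and>
        digital_homotopic_fixing y\<^sub>1 Y \<mu> Y \<mu> (f \<circ> g) id)"

text \<open>
  The sequences of sets and maps are indexed by \<open>j \<ge> 1\<close>; their values at \<open>0\<close> are unused. In
  the last two conditions the inclusions \<open>f w ` Xs v \<subseteq> Ys v\<close> and \<open>g w ` Ys v \<subseteq> Xs v\<close> are part of
  \<open>digital_homotopic\<close>.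
\<close>

definition homotopically_similar ::
  "'a set \<Rightarrow> ('a \<Rightarrow> 'a \<Rightarrow> bool) \<Rightarrow> 'b set \<Rightarrow> ('b \<Rightarrow> 'b \<Rightarrow> bool) \<Rightarrow> bool" where
  "homotopically_similar X \<kappa> Y \<mu> \<longleftrightarrow>
     (\<exists>(Xs :: nat \<Rightarrow> 'a set) (Ys :: nat \<Rightarrow> 'b set) f g.
        (\<forall>j\<ge>1. Xs j \<subseteq> Xs (j + 1) \<and> Ys j \<subseteq> Ys (j + 1)) \<and>
        X = (\<Union>j\<in>{1..}. Xs j) \<and> Y = (\<Union>j\<in>{1..}. Ys j) \<and>
        (\<forall>j\<ge>1. digital_continuous (Xs j) \<kappa> (Ys j) \<mu> (f j) \<and>
                digital_continuous (Ys j) \<mu> (Xs j) \<kappa> (g j) \<and>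
                digital_homotopic (Xs j) \<kappa> (Xs j) \<kappa> (g j \<circ> f j) id \<and>
                digital_homotopic (Ys j) \<mu> (Ys j) \<mu> (f j \<circ> g j) id) \<and>
        (\<forall>v w. 1 \<le> v \<and> v \<le> w \<longrightarrow>
                digital_homotopic (Xs v) \<kappa> (Ys v) \<mu> (f w) (f v) \<and>
                digital_homotopic (Ys v) \<mu> (Xs v) \<kappa> (g w) (g v)))"

definition pointed_homotopically_similar ::
  "'a set \<Rightarrow> 'a \<Rightarrow> ('a \<Rightarrow> 'a \<Rightarrow> bool) \<Rightarrow> 'b set \<Rightarrow> 'b \<Rightarrow> ('b \<Rightarrow> 'b \<Rightarrow> bool) \<Rightarrow> bool" where
  "pointed_homotopically_similar X x\<^sub>1 \<kappa> Y y\<^sub>1 \<mu> \<longleftrightarrow>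
     (\<exists>(Xs :: nat \<Rightarrow> 'a set) (Ys :: nat \<Rightarrow> 'b set) f g.
        (\<forall>j\<ge>1. Xs j \<subseteq> Xs (j + 1) \<and> Ys j \<subseteq> Ys (j + 1)) \<and>
        X = (\<Union>j\<in>{1..}. Xs j) \<and> Y = (\<Union>j\<in>{1..}. Ys j) \<and>
        x\<^sub>1 \<in> Xs 1 \<and> y\<^sub>1 \<in> Ys 1 \<and>
        (\<forall>j\<ge>1. digital_continuous (Xs j) \<kappa> (Ys j) \<mu> (f j) \<and>
                digital_continuous (Ys j) \<mu> (Xs j) \<kappa> (g j) \<and>
                f j x\<^sub>1 = y\<^sub>1 \<and> g j y\<^sub>1 = x\<^sub>1 \<and>
                digital_homotopic_fixing x\<^sub>1 (Xs j) \<kappa> (Xs j) \<kappa> (g j \<circ> f j) id \<and>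
                digital_homotopic_fixing y\<^sub>1 (Ys j) \<mu> (Ys j) \<mu> (f j \<circ> g j) id) \<and>
        (\<forall>v w. 1 \<le> v \<and> v \<le> w \<longrightarrow>
                digital_homotopic_fixing x\<^sub>1 (Xs v) \<kappa> (Ys v) \<mu> (f w) (f v) \<and>
                digital_homotopic_fixing y\<^sub>1 (Ys v) \<mu> (Xs v) \<kappa> (g w) (g v)))"

end

theory Submission
  imports Defs
begin

text \<open>
  The constant sequences \<open>X\<^sub>j = X\<close>, \<open>Y\<^sub>j = Y\<close>, \<open>f\<^sub>j = f\<close>, \<open>g\<^sub>j = g\<close> built from a (pointed) homotopy
  equivalence witness homotopic similarity: the compatibility conditions become \<open>f \<simeq> f\<close> and
  \<open>g \<simeq> g\<close>, which hold by stationary homotopies.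
\<close>

text \<open>The image of any set has at most one point, so it is vacuously connected. This serves
  for the time tracks of stationary homotopies.\<close>

lemma digital_continuous_const:
  assumes "c \<in> Y"
  shows "digital_continuous X \<kappa> Y \<mu> (\<lambda>_. c)"
  using assms by (auto simp: digital_continuous_def digital_connected_def)

text \<open>The stationary homotopy moves no point, so it settles the pointed and the unpointed case
  at once.\<close>

lemma digital_homotopic_fixing_refl:
  assumes "digital_continuous X \<kappa> Y \<mu> f"
  shows "digital_homotopic_fixing x X \<kappa> Y \<mu> f f"
proof -
  have "f ` X \<subseteq> Y"
    using assms by (simp add: digital_continuous_def)
  \<comment> \<open>Length \<open>1\<close> is the least that \<open>m > 0\<close> allows. Each time
    slice of \<open>f \<circ> fst\<close> is \<open>f\<close>, and each track is constant at
    \<open>f x\<close>, which lies in \<open>Y\<close>.\<close>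
  then have "digital_homotopy X \<kappa> Y \<mu> f f 1 (f \<circ> fst)"
    using assms by (auto simp: digital_homotopy_def intro!: digital_continuous_const)
  moreover have "holds_fixed (f \<circ> fst) 1 x"
    by (simp add: holds_fixed_def)
  ultimately show ?thesis
    unfolding digital_homotopic_fixing_def by blast
qed

lemma digital_homotopic_refl:
  assumes "digital_continuous X \<kappa> Y \<mu> f"
  shows "digital_homotopic X \<kappa> Y \<mu> f f"
  using digital_homotopic_fixing_refl[OF assms]
  unfolding digital_homotopic_fixing_def digital_homotopic_def by blast

lemma same_homotopy_type_imp_homotopically_similar:
  assumes "same_homotopy_type X \<kappa> Y \<mu>"
  shows "homotopically_similar X \<kappa> Y \<mu>"
proof -
  obtain f g where "digital_continuous X \<kappa> Y \<mu> f" "digital_continuous Y \<mu> X \<kappa> g"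
    "digital_homotopic X \<kappa> X \<kappa> (g \<circ> f) id" "digital_homotopic Y \<mu> Y \<mu> (f \<circ> g) id"
    using assms unfolding same_homotopy_type_def by blast
  then show ?thesis
    unfolding homotopically_similar_def
    \<comment> \<open>The constant families have unions \<open>X\<close> and \<open>Y\<close>
      because the index set \<open>{1..}\<close> is nonempty.\<close>
    by (intro exI[of _ "\<lambda>_. X"] exI[of _ "\<lambda>_. Y"] exI[of _ "\<lambda>_. f"] exI[of _ "\<lambda>_. g"])
      (auto intro: digital_homotopic_refl)
qed

lemma same_pointed_homotopy_type_imp_pointed_homotopically_similar:
  assumes "same_pointed_homotopy_type X x \<kappa> Y y \<mu>" and "x \<in> X" and "y \<in> Y"
  shows "pointed_homotopically_similar X x \<kappa> Y y \<mu>"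
proof -
  obtain f g where "digital_continuous X \<kappa> Y \<mu> f" "digital_continuous Y \<mu> X \<kappa> g"
    "f x = y" "g y = x"
    "digital_homotopic_fixing x X \<kappa> X \<kappa> (g \<circ> f) id"
    "digital_homotopic_fixing y Y \<mu> Y \<mu> (f \<circ> g) id"
    using assms(1) unfolding same_pointed_homotopy_type_def by blast
  then show ?thesis
    \<comment> \<open>Membership of the base points yields \<open>x \<in> Xs 1\<close> and
      \<open>y \<in> Ys 1\<close>; the pointed equivalence does not record it.\<close>
    using assms(2,3) unfolding pointed_homotopically_similar_def
    by (intro exI[of _ "\<lambda>_. X"] exI[of _ "\<lambda>_. Y"] exI[of _ "\<lambda>_. f"] exI[of _ "\<lambda>_. g"])
      (auto intro: digital_homotopic_fixing_refl)
qed

theorem proposition3p2: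
  fixes X :: "(int ^ 'm) set" and \<kappa> :: "int ^ 'm \<Rightarrow> int ^ 'm \<Rightarrow> bool"
    and Y :: "(int ^ 'n) set" and \<mu> :: "int ^ 'n \<Rightarrow> int ^ 'n \<Rightarrow> bool"
  assumes "digital_image X \<kappa>" and "digital_image Y \<mu>"
  shows "(same_homotopy_type X \<kappa> Y \<mu> \<longrightarrow> homotopically_similar X \<kappa> Y \<mu>) \<and>
         (\<forall>x\<^sub>1\<in>X. \<forall>y\<^sub>1\<in>Y. same_pointed_homotopy_type X x\<^sub>1 \<kappa> Y y\<^sub>1 \<mu> \<longrightarrow>
            pointed_homotopically_similar X x\<^sub>1 \<kappa> Y y\<^sub>1 \<mu>)"
  by (blast intro: same_homotopy_type_imp_homotopically_similar
      same_pointed_homotopy_type_imp_pointed_homotopically_similar)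

end
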